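(* Let $i\in\{1,2\}$ and $\alpha\in\{0,1,2\}$. There exist constants $C_{i\alpha}^{12,\mu}$ and polynomials $C_{i\alpha}^{0,\mu}(\omega)$, $C_{i\alpha}^{\mu}(\omega)$, $C_{i\alpha}^{\mu\nu,1}(\omega)$, $C_{i\alpha}^{\mu\nu,2}(\omega)$ in $\omega=x/|x|$ ($\mu,\nu\in\{0,1,2\}$) such that for any smooth functions $f,g$ of $(t,x)$ and for $x\ne0$, $$\begin{aligned}Q_{0i}(\partial_\alpha f,g)&=\sum_{\mu=0}^2\Big\{C_{i\alpha}^{12,\mu}Q_{12}(\partial_\mu f,g)+C_{i\alpha}^{0,\mu}(\omega)Q_0(\partial_\mu f,g)+C_{i\alpha}^{\mu}(\omega)\,\Box f\,\partial_\mu g\Big\}\\&\quad+\sum_{\mu,\nu=0}^2\frac{C_{i\alpha}^{\mu\nu,1}(\omega)\,\Omega\partial_\mu f\,\partial_\nu g+C_{i\alpha}^{\mu\nu,2}(\omega)\,\Omega g\,\partial^2_{\mu\nu}f}{|x|}.\end{aligned}$$ Furthermore, for $x\neq 0$, $$\begin{aligned}Q_{0i}(\partial_\alpha f,g)&=\sum_{\mu=0}^2\Big\{C_{i\alpha}^{12,\mu}Q_{12}(\partial_\mu f,g)+C_{i\alpha}^{0,\mu}(\omega)Q_0(\partial_\mu f,g)+C_{i\alpha}^{\mu}(\omega)\,\Box f\,\partial_\mu g\Big\}\\&\quad+\sum_{\mu=0}^2\partial_\mu\Big(\frac{C(\omega)\,g\,\Omega\partial f}{|x|}\Big)+\partial_\theta\Big(\frac{C(\omega)\,g\,\partial^2f}{|x|}\Big)+\frac{C(\omega)\,g\,\Omega\partial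 f}{|x|^2},\end{aligned}$$ where $C(\omega)$ stands for a generic polynomial of $\omega$.
   Context: $x\in\mathbb R^2$, $\partial=(\partial_0,\partial_1,\partial_2)=(\partial_t,\partial_{x_1},\partial_{x_2})$, $\Box=\partial_t^2-\partial_1^2-\partial_2^2$, $\Omega=\partial_\theta=x_1\partial_2-x_2\partial_1$, $\omega=(\omega_1,\omega_2)=x/|x|$. The null forms are $Q_0(f,g)=\partial_tf\partial_tg-\sum_{j=1}^2\partial_jf\partial_jg$ and $Q_{\alpha\beta}(f,g)=\partial_\alpha f\partial_\beta g-\partial_\beta f\partial_\alpha g$. Schematic convention: an expression such as $C(\omega)\,g\,\Omega\partial f$ (resp. $C(\omega)\,g\,\partial^2f$) stands for a finite linear combination, with coefficients universal polynomials in $\omega$ (independent of $f,g$, possibly different at each occurrence and depending on $i,\alpha,\mu$), of the terms $g\,\Omega\partial_\nu f$, $0\le\nu\le2$ (resp. $g\,\partial^2_{\nu\lambda}f$, $0\le\nu,\lambda\le2$). *)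

theory Defs
  imports "HOL-Analysis.Analysis"
begin

text \<open>A point of space-time is a pair \<open>(t, x)\<close> with \<open>t\<close> real and \<open>x\<close> in the plane.
  Space-time indices are the natural numbers 0, 1, 2, with 0 for time; \<open>coord_dir\<close> is only
  meaningful for these.\<close>

type_synonym spacetime = "real \<times> (real^2)"

definition coord_dir :: "nat \<Rightarrow> spacetime" where
  "coord_dir \<mu> =
     (if \<mu> = 0 then (1, 0) else if \<mu> = 1 then (0, axis 1 1) else (0, axis 2 1))"

definition pd :: "nat \<Rightarrow> (spacetime \<Rightarrow> real) \<Rightarrow> spacetime \<Rightarrow> real" where
  "pd \<mu> f z = deriv (\<lambda>h. f (z + h *\<^sub>R coord_dir \<mu>)) 0"

text \<open>Since \<open>pd\<close> is total, differentiability has to be demanded explicitly at every order.\<close>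

primrec C_k :: "nat \<Rightarrow> (spacetime \<Rightarrow> real) \<Rightarrow> bool" where
  "C_k 0 f \<longleftrightarrow> continuous_on UNIV f"
| "C_k (Suc k) f \<longleftrightarrow> (\<forall>z. f differentiable (at z)) \<and> (\<forall>\<mu>\<in>{0..2}. C_k k (pd \<mu> f))"

definition smooth :: "(spacetime \<Rightarrow> real) \<Rightarrow> bool" where
  "smooth f \<longleftrightarrow> (\<forall>k. C_k k f)"

definition dAlembert :: "(spacetime \<Rightarrow> real) \<Rightarrow> spacetime \<Rightarrow> real" where
  "dAlembert f z = pd 0 (pd 0 f) z - pd 1 (pd 1 f) z - pd 2 (pd 2 f) z"

text \<open>The rotation field, i.e. the angular derivative.\<close>

definition Rot :: "(spacetime \<Rightarrow> real) \<Rightarrow> spacetime \<Rightarrow> real" where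
  "Rot f z = (snd z $ 1) * pd 2 f z - (snd z $ 2) * pd 1 f z"

definition Q0 :: "(spacetime \<Rightarrow> real) \<Rightarrow> (spacetime \<Rightarrow> real) \<Rightarrow> spacetime \<Rightarrow> real" where
  "Q0 f g z = pd 0 f z * pd 0 g z - (\<Sum>j=1..2. pd j f z * pd j g z)"

definition Q :: "nat \<Rightarrow> nat \<Rightarrow> (spacetime \<Rightarrow> real) \<Rightarrow> (spacetime \<Rightarrow> real) \<Rightarrow> spacetime \<Rightarrow> real" where
  "Q \<alpha> \<beta> f g z = pd \<alpha> f z * pd \<beta> g z - pd \<beta> f z * pd \<alpha> g z"

text \<open>The spatial radius \<open>|x|\<close> and direction \<open>\<omega> = x/|x|\<close>; the latter is \<open>0\<close> at \<open>x = 0\<close>.\<close>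

definition rad :: "spacetime \<Rightarrow> real" where
  "rad z = norm (snd z)"

definition omega :: "spacetime \<Rightarrow> real^2" where
  "omega z = sgn (snd z)"

end

theory Submission
  imports Defs
begin

text \<open>
  For \<open>\<alpha> = 0\<close> the difference \<open>Q\<^sub>0\<^sub>i(\<partial>\<^sub>t f, g) + Q\<^sub>0(\<partial>\<^sub>i f, g) - \<box>f \<partial>\<^sub>i g\<close> is exactly
  \<open>\<mp>Q\<^sub>1\<^sub>2(\<partial>\<^sub>j f, g)\<close>, where \<open>{i, j} = {1, 2}\<close>; no error term occurs.

  For \<open>\<alpha> = k \<noteq> 0\<close> write \<open>\<omega>'\<close> for \<open>\<omega>\<close> rotated by a right angle. Modulo derivatives tangential
  to circles, \<open>\<partial>\<^sub>j\<close> is \<open>\<omega>\<^sub>j \<partial>\<^sub>r\<close>, and then \<open>Q\<^sub>0\<^sub>i(\<partial>\<^sub>k f, g)\<close> becomes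
  \<open>\<omega>\<^sub>i \<omega>\<^sub>k (\<box>f \<partial>\<^sub>t g - Q\<^sub>0(\<partial>\<^sub>t f, g))\<close>. Keeping the tangential derivatives, the error is
  \<open>(\<omega>'\<^sub>i (\<partial>\<^sub>t\<partial>\<^sub>k f \<Omega>g - \<Omega>\<partial>\<^sub>k f \<partial>\<^sub>t g) - \<epsilon>\<^sub>k\<^sub>l \<omega>\<^sub>i (\<Omega>\<partial>\<^sub>t f \<partial>\<^sub>l g - \<Omega>\<partial>\<^sub>l f \<partial>\<^sub>t g)) / |x|\<close>.
  When every derivative is moved off \<open>g\<close>, the third order terms in \<open>f\<close> cancel, and the term
  \<open>\<omega>\<^sub>i g \<partial>\<^sub>t\<partial>\<^sub>k f / |x|\<close> produced by \<open>\<Omega>\<omega>'\<^sub>i = -\<omega>\<^sub>i\<close> cancels against the one produced by the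
  commutator of \<open>\<partial>\<^sub>l\<close> and \<open>\<Omega>\<close>. What survives comes from differentiating \<open>\<omega>\<^sub>i / |x|\<close>.
\<close>

section \<open>Partial derivatives as a relation\<close>

text \<open>Unlike the total function \<open>pd\<close>, this relation carries existence of the
  derivative, so the product and sum rules compose.\<close>

definition has_pd :: "nat \<Rightarrow> (spacetime \<Rightarrow> real) \<Rightarrow> real \<Rightarrow> spacetime \<Rightarrow> bool" where
  "has_pd \<mu> f D z \<longleftrightarrow> ((\<lambda>h. f (z + h *\<^sub>R coord_dir \<mu>)) has_real_derivative D) (at 0)"

lemma pd_eqI: "has_pd \<mu> f D z \<Longrightarrow> pd \<mu> f z = D"
  unfolding has_pd_def pd_def by (rule DERIV_imp_deriv)

lemma has_pd_mult:
  assumes "has_pd \<mu> f D z" and "has_pd \<mu> g E z"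
  shows "has_pd \<mu> (\<lambda>y. f y * g y) (D * g z + f z * E) z"
  using DERIV_mult[OF assms[unfolded has_pd_def]] by (simp add: has_pd_def algebra_simps)

lemma has_pd_add:
  "has_pd \<mu> f D z \<Longrightarrow> has_pd \<mu> g E z \<Longrightarrow> has_pd \<mu> (\<lambda>y. f y + g y) (D + E) z"
  unfolding has_pd_def by (rule DERIV_add)

lemma has_pd_minus: "has_pd \<mu> f D z \<Longrightarrow> has_pd \<mu> (\<lambda>y. - f y) (- D) z"
  unfolding has_pd_def by (rule DERIV_minus)

lemma has_pd_cmult: "has_pd \<mu> f D z \<Longrightarrow> has_pd \<mu> (\<lambda>y. c * f y) (c * D) z"
  unfolding has_pd_def by (rule DERIV_cmult)

lemma has_pd_const: "has_pd \<mu> (\<lambda>y. c) 0 z"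
  unfolding has_pd_def by simp

lemma has_pd_eq_rhs: "has_pd \<mu> f D z \<Longrightarrow> D = E \<Longrightarrow> has_pd \<mu> f E z"
  by simp

lemma Rot_eqI:
  "has_pd 1 f D1 z \<Longrightarrow> has_pd 2 f D2 z \<Longrightarrow> Rot f z = snd z $ 1 * D2 - snd z $ 2 * D1"
  by (simp add: Rot_def pd_eqI)

lemma smooth_pd: "smooth f \<Longrightarrow> \<mu> \<le> 2 \<Longrightarrow> smooth (pd \<mu> f)"
  unfolding smooth_def by (metis C_k.simps(2) atLeastAtMost_iff le0)

lemma smooth_differentiable: "smooth f \<Longrightarrow> f differentiable (at z)"
  unfolding smooth_def by (metis C_k.simps(2))

text \<open>The chain rule for the total derivative. Having it at every parameter \<open>s\<close>,
  not only at 0, makes the mean value theorem applicable along coordinate lines.\<close>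

lemma smooth_line_derivative:
  assumes "smooth f"
  shows "((\<lambda>h. f (z + h *\<^sub>R coord_dir \<mu>)) has_real_derivative
           pd \<mu> f (z + s *\<^sub>R coord_dir \<mu>)) (at s)"
proof -
  let ?w = "z + s *\<^sub>R coord_dir \<mu>"
  obtain f' where f': "(f has_derivative f') (at ?w)"
    using smooth_differentiable[OF assms] unfolding differentiable_def by blast
  then interpret f': bounded_linear f' by (rule has_derivative_bounded_linear)
  \<comment> \<open>Used twice: \<open>w = ?w\<close>, \<open>t = 0\<close> identifies
    \<open>pd\<close>; \<open>w = z\<close>, \<open>t = s\<close> gives the claim.\<close>
  have line: "((\<lambda>h. f (w + h *\<^sub>R coord_dir \<mu>)) has_real_derivative f' (coord_dir \<mu>)) (at t)"
    if "w + t *\<^sub>R coord_dir \<mu> = ?w" for w t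
  proof -
    have "((\<lambda>h. w + h *\<^sub>R coord_dir \<mu>) has_derivative (\<lambda>h. h *\<^sub>R coord_dir \<mu>)) (at t)"
      by (auto intro!: derivative_eq_intros)
    from has_derivative_compose[OF this] f' that
    have "((\<lambda>h. f (w + h *\<^sub>R coord_dir \<mu>)) has_derivative (\<lambda>h. f' (h *\<^sub>R coord_dir \<mu>))) (at t)"
      by simp
    then show ?thesis
      by (simp add: has_field_derivative_def f'.scaleR mult.commute[of _ "f' (coord_dir \<mu>)"])
  qed
  have "pd \<mu> f ?w = f' (coord_dir \<mu>)"
    by (rule pd_eqI) (simp add: has_pd_def line)
  then show ?thesis using line by simp
qed

lemma has_pd_smooth: "smooth f \<Longrightarrow> has_pd \<mu> f (pd \<mu> f z) z"
  using smooth_line_derivative[of f z \<mu> 0] by (simp add: has_pd_def)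

section \<open>Symmetry of second partial derivatives\<close>

text \<open>The mean value theorem is applied in direction \<open>\<mu>\<close> to the increment
  over \<open>h\<close> in direction \<open>\<nu>\<close>, then in direction \<open>\<nu>\<close> to
  \<open>pd \<mu> f\<close>.\<close>

lemma second_difference_mean_value:
  assumes "smooth f" and "\<mu> \<le> 2" and "0 < h"
  shows "\<exists>\<xi> \<eta>. 0 < \<xi> \<and> \<xi> < h \<and> 0 < \<eta> \<and> \<eta> < h \<and>
    f (z + h *\<^sub>R coord_dir \<mu> + h *\<^sub>R coord_dir \<nu>) - f (z + h *\<^sub>R coord_dir \<mu>)
      - f (z + h *\<^sub>R coord_dir \<nu>) + f z
    = h\<^sup>2 * pd \<nu> (pd \<mu> f) (z + \<xi> *\<^sub>R coord_dir \<mu> + \<eta> *\<^sub>R coord_dir \<nu>)"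
proof -
  let ?a = "coord_dir \<mu>" and ?b = "coord_dir \<nu>"
  let ?G = "\<lambda>s. f (z + h *\<^sub>R ?b + s *\<^sub>R ?a) - f (z + s *\<^sub>R ?a)"
  have "(?G has_real_derivative
      pd \<mu> f (z + h *\<^sub>R ?b + s *\<^sub>R ?a) - pd \<mu> f (z + s *\<^sub>R ?a)) (at s)" for s
    by (intro DERIV_diff smooth_line_derivative assms)
  from MVT2[OF \<open>0 < h\<close> this] obtain \<xi> where \<xi>: "0 < \<xi>" "\<xi> < h"
    and G: "?G h - ?G 0 = h * (pd \<mu> f (z + h *\<^sub>R ?b + \<xi> *\<^sub>R ?a) - pd \<mu> f (z + \<xi> *\<^sub>R ?a))"
    by auto
  have "((\<lambda>t. pd \<mu> f (z + \<xi> *\<^sub>R ?a + t *\<^sub>R ?b)) has_real_derivative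
      pd \<nu> (pd \<mu> f) (z + \<xi> *\<^sub>R ?a + t *\<^sub>R ?b)) (at t)" for t
    by (intro smooth_line_derivative smooth_pd assms)
  from MVT2[OF \<open>0 < h\<close> this] obtain \<eta> where \<eta>: "0 < \<eta>" "\<eta> < h"
    and H: "pd \<mu> f (z + \<xi> *\<^sub>R ?a + h *\<^sub>R ?b) - pd \<mu> f (z + \<xi> *\<^sub>R ?a)
      = h * pd \<nu> (pd \<mu> f) (z + \<xi> *\<^sub>R ?a + \<eta> *\<^sub>R ?b)"
    by auto
  have "?G h - ?G 0 = h\<^sup>2 * pd \<nu> (pd \<mu> f) (z + \<xi> *\<^sub>R ?a + \<eta> *\<^sub>R ?b)"
    unfolding G power2_eq_square mult.assoc H[symmetric] by (simp add: add_ac)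
  with \<xi> \<eta> show ?thesis
    by (intro exI[of _ \<xi>] exI[of _ \<eta>]) (simp add: add_ac)
qed

lemma smooth_close_on_box:
  assumes "smooth f" and "0 < e"
  shows "\<exists>d>0. \<forall>\<xi> \<eta>. 0 < \<xi> \<and> \<xi> < d \<and> 0 < \<eta> \<and> \<eta> < d \<longrightarrow>
    \<bar>f (z + \<xi> *\<^sub>R coord_dir \<mu> + \<eta> *\<^sub>R coord_dir \<nu>) - f z\<bar> < e"
proof -
  let ?a = "coord_dir \<mu>" and ?b = "coord_dir \<nu>"
  have "isCont f z"
    by (rule differentiable_imp_continuous_within[OF smooth_differentiable[OF assms(1)]])
  then obtain d where d: "d > 0" "\<And>y. dist y z < d \<Longrightarrow> dist (f y) (f z) < e"
    using assms(2) unfolding continuous_at Lim_at by (metis dist_self zero_less_dist_iff)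
  have norm1: "norm (coord_dir \<kappa>) = 1" for \<kappa>
    by (simp add: coord_dir_def norm_Pair)
  show ?thesis
  proof (intro exI[of _ "d / 2"] conjI allI impI)
    fix \<xi> \<eta> assume *: "0 < \<xi> \<and> \<xi> < d / 2 \<and> 0 < \<eta> \<and> \<eta> < d / 2"
    have "norm (\<xi> *\<^sub>R ?a + \<eta> *\<^sub>R ?b) \<le> \<xi> + \<eta>"
      using norm_triangle_ineq[of "\<xi> *\<^sub>R ?a" "\<eta> *\<^sub>R ?b"] * by (simp add: norm1)
    then have "dist (z + \<xi> *\<^sub>R ?a + \<eta> *\<^sub>R ?b) z < d"
      using * by (simp add: dist_norm add.assoc)
    from d(2)[OF this] show "\<bar>f (z + \<xi> *\<^sub>R ?a + \<eta> *\<^sub>R ?b) - f z\<bar> < e"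
      by (simp add: dist_real_def)
  qed (use d in auto)
qed

text \<open>The second difference is symmetric in the two directions, so both mixed derivatives take
  a common value arbitrarily close to \<open>z\<close>; continuity then forces equality.\<close>

lemma pd_commute:
  assumes f: "smooth f" and "\<mu> \<le> 2" and "\<nu> \<le> 2"
  shows "pd \<mu> (pd \<nu> f) z = pd \<nu> (pd \<mu> f) z"
proof (rule ccontr)
  let ?p = "pd \<mu> (pd \<nu> f)" and ?q = "pd \<nu> (pd \<mu> f)"
  assume "?p z \<noteq> ?q z"
  \<comment> \<open>Half the gap: no number lies within \<open>e\<close> of both values.\<close>
  define e where "e = \<bar>?p z - ?q z\<bar> / 2"
  have e: "0 < e" using \<open>?p z \<noteq> ?q z\<close> by (simp add: e_def)
  have sp: "smooth ?p" and sq: "smooth ?q" using assms by (auto intro: smooth_pd)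
  from smooth_close_on_box[OF sp e, of z \<nu> \<mu>] obtain d1 where d1: "d1 > 0"
    "\<And>\<xi> \<eta>. 0 < \<xi> \<and> \<xi> < d1 \<and> 0 < \<eta> \<and> \<eta> < d1 \<Longrightarrow>
      \<bar>?p (z + \<xi> *\<^sub>R coord_dir \<nu> + \<eta> *\<^sub>R coord_dir \<mu>) - ?p z\<bar> < e" by blast
  from smooth_close_on_box[OF sq e, of z \<mu> \<nu>] obtain d2 where d2: "d2 > 0"
    "\<And>\<xi> \<eta>. 0 < \<xi> \<and> \<xi> < d2 \<and> 0 < \<eta> \<and> \<eta> < d2 \<Longrightarrow>
      \<bar>?q (z + \<xi> *\<^sub>R coord_dir \<mu> + \<eta> *\<^sub>R coord_dir \<nu>) - ?q z\<bar> < e" by blast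
  define h where "h = min d1 d2"
  have h: "h > 0" "h \<le> d1" "h \<le> d2" using d1 d2 by (auto simp: h_def)
  obtain \<xi> \<eta> where 1: "0 < \<xi>" "\<xi> < h" "0 < \<eta>" "\<eta> < h"
    and A: "f (z + h *\<^sub>R coord_dir \<nu> + h *\<^sub>R coord_dir \<mu>) - f (z + h *\<^sub>R coord_dir \<nu>)
      - f (z + h *\<^sub>R coord_dir \<mu>) + f z
      = h\<^sup>2 * ?p (z + \<xi> *\<^sub>R coord_dir \<nu> + \<eta> *\<^sub>R coord_dir \<mu>)"
    using second_difference_mean_value[OF f \<open>\<nu> \<le> 2\<close> h(1), of z \<mu>] by blast
  obtain \<xi>' \<eta>' where 2: "0 < \<xi>'" "\<xi>' < h" "0 < \<eta>'" "\<eta>' < h"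
    and B: "f (z + h *\<^sub>R coord_dir \<mu> + h *\<^sub>R coord_dir \<nu>) - f (z + h *\<^sub>R coord_dir \<mu>)
      - f (z + h *\<^sub>R coord_dir \<nu>) + f z
      = h\<^sup>2 * ?q (z + \<xi>' *\<^sub>R coord_dir \<mu> + \<eta>' *\<^sub>R coord_dir \<nu>)"
    using second_difference_mean_value[OF f \<open>\<mu> \<le> 2\<close> h(1), of z \<nu>] by blast
  have "h\<^sup>2 * ?p (z + \<xi> *\<^sub>R coord_dir \<nu> + \<eta> *\<^sub>R coord_dir \<mu>)
      = h\<^sup>2 * ?q (z + \<xi>' *\<^sub>R coord_dir \<mu> + \<eta>' *\<^sub>R coord_dir \<nu>)"
    unfolding A[symmetric] B[symmetric] by (simp add: add_ac)
  then have "?p (z + \<xi> *\<^sub>R coord_dir \<nu> + \<eta> *\<^sub>R coord_dir \<mu>)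
      = ?q (z + \<xi>' *\<^sub>R coord_dir \<mu> + \<eta>' *\<^sub>R coord_dir \<nu>)"
    using h(1) by simp
  moreover have "\<bar>?p (z + \<xi> *\<^sub>R coord_dir \<nu> + \<eta> *\<^sub>R coord_dir \<mu>) - ?p z\<bar> < e"
    using 1 h by (intro d1(2)) auto
  moreover have "\<bar>?q (z + \<xi>' *\<^sub>R coord_dir \<mu> + \<eta>' *\<^sub>R coord_dir \<nu>) - ?q z\<bar> < e"
    using 2 h by (intro d2(2)) auto
  ultimately show False unfolding e_def by argo
qed

section \<open>Derivatives of the rotation field and of omega/|x|\<close>

lemma has_pd_snd:
  "has_pd \<mu> (\<lambda>y. snd y $ n) (snd (coord_dir \<mu>) $ n) z"
  unfolding has_pd_def by (auto intro!: derivative_eq_intros)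

lemma coord_dir_nth:
  "snd (coord_dir 0) $ n = 0"
  "snd (coord_dir 1) $ 1 = 1" "snd (coord_dir 1) $ 2 = 0"
  "snd (coord_dir 2) $ 1 = 0" "snd (coord_dir 2) $ 2 = 1"
  by (simp_all add: coord_dir_def axis_def)

text \<open>The last two terms are the commutator of \<open>pd \<mu>\<close> with
  \<open>Rot\<close>: 0 for time, \<open>pd 2 f\<close> for \<open>\<mu> = 1\<close>,
  \<open>- pd 1 f\<close> for \<open>\<mu> = 2\<close>.\<close>

lemma has_pd_Rot:
  assumes "smooth f" "\<mu> \<le> 2"
  shows "has_pd \<mu> (Rot f) (Rot (pd \<mu> f) z + snd (coord_dir \<mu>) $ 1 * pd 2 f z
           - snd (coord_dir \<mu>) $ 2 * pd 1 f z) z"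
proof -
  have "has_pd \<mu> (\<lambda>y. snd y $ 1 * pd 2 f y + - (snd y $ 2 * pd 1 f y))
     ((snd (coord_dir \<mu>) $ 1 * pd 2 f z + snd z $ 1 * pd \<mu> (pd 2 f) z)
      + - (snd (coord_dir \<mu>) $ 2 * pd 1 f z + snd z $ 2 * pd \<mu> (pd 1 f) z)) z"
    by (intro has_pd_add has_pd_minus has_pd_mult has_pd_snd has_pd_smooth smooth_pd assms) auto
  moreover have "(\<lambda>y. snd y $ 1 * pd 2 f y + - (snd y $ 2 * pd 1 f y)) = Rot f"
    by (auto simp: Rot_def)
  moreover have "pd \<mu> (pd 2 f) z = pd 2 (pd \<mu> f) z" "pd \<mu> (pd 1 f) z = pd 1 (pd \<mu> f) z"
    using assms by (auto intro!: pd_commute)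
  ultimately show ?thesis by (simp add: Rot_def algebra_simps)
qed

lemma rad_sq: "(rad z)\<^sup>2 = (snd z $ 1)\<^sup>2 + (snd z $ 2)\<^sup>2"
  by (simp add: rad_def norm_vec_def L2_set_def sum_2 real_sqrt_pow2)

lemma omega_nth: "omega z $ n = snd z $ n / rad z"
  by (simp add: omega_def sgn_div_norm rad_def divide_inverse mult.commute)

lemma has_pd_omega_div_rad:
  assumes "snd z \<noteq> 0"
  shows "has_pd \<mu> (\<lambda>y. omega y $ n / rad y)
    ((snd (coord_dir \<mu>) $ n - 2 * omega z $ n *
      (omega z $ 1 * snd (coord_dir \<mu>) $ 1 + omega z $ 2 * snd (coord_dir \<mu>) $ 2)) / (rad z)\<^sup>2) z"
proof -
  let ?c = "coord_dir \<mu>"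
  have r: "rad z > 0" using assms by (simp add: rad_def)
  then have ne: "(snd z $ 1)\<^sup>2 + (snd z $ 2)\<^sup>2 \<noteq> 0" unfolding rad_sq[symmetric] by simp
  \<comment> \<open>Rational in the coordinates. The equality also holds at x = 0, where both sides
    are 0 by the convention for division.\<close>
  have eq: "(\<lambda>y. omega y $ n / rad y) = (\<lambda>y. snd y $ n / ((snd y $ 1)\<^sup>2 + (snd y $ 2)\<^sup>2))"
    by (simp add: omega_nth rad_sq[symmetric] power2_eq_square[of "rad _"])
  have *: "((\<lambda>h. snd (z + h *\<^sub>R ?c) $ n / ((snd (z + h *\<^sub>R ?c) $ 1)\<^sup>2 + (snd (z + h *\<^sub>R ?c) $ 2)\<^sup>2))
    has_real_derivative (snd ?c $ n * (rad z)\<^sup>2 - snd z $ n * (2 * snd z $ 1 * snd ?c $ 1 + 2 * snd z $ 2 * snd ?c $ 2))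
      / ((rad z)\<^sup>2 * (rad z)\<^sup>2)) (at 0)"
    unfolding rad_sq using ne by (auto intro!: derivative_eq_intros)
  have **: "(a * r\<^sup>2 - b * (2 * x * c + 2 * y * d)) / (r\<^sup>2 * r\<^sup>2)
      = (a - 2 * (b / r) * (x / r * c + y / r * d)) / r\<^sup>2" if "r > 0" for a b c d x y r :: real
    using that by (simp add: field_simps power2_eq_square)
  show ?thesis unfolding has_pd_def eq
    by (rule DERIV_cong[OF *]) (simp only: omega_nth **[OF r])
qed

lemma rad_omega: "snd z \<noteq> 0 \<Longrightarrow> snd z $ n = rad z * omega z $ n"
  by (simp add: omega_nth rad_def)

lemma omega_unit:
  assumes "snd z \<noteq> 0"
  shows "(omega z $ 1)\<^sup>2 + (omega z $ 2)\<^sup>2 = 1"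
proof -
  have "rad z \<noteq> 0" using assms by (simp add: rad_def)
  then show ?thesis
    by (simp add: omega_nth power_divide add_divide_distrib[symmetric] rad_sq[symmetric])
qed

lemma Rot_eq_omega:
  "snd z \<noteq> 0 \<Longrightarrow> Rot f z = rad z * (omega z $ 1 * pd 2 f z - omega z $ 2 * pd 1 f z)"
  by (simp add: Rot_def rad_omega algebra_simps)

section \<open>Null-form identities and their error terms\<close>

lemma sum_0_2: "(\<Sum>j=0..2. h j) = h 0 + h 1 + h (2::nat)" for h :: "nat \<Rightarrow> real"
  by (simp add: numeral_2_eq_2)

lemma sum_1_2: "(\<Sum>j=1..2. h j) = h 1 + h (2::nat)" for h :: "nat \<Rightarrow> real"
  by (simp add: numeral_2_eq_2)

text \<open>\<open>k\<close> and \<open>l\<close> are the two spatial indices in either order, \<open>n\<close> and \<open>m\<close> the same indices as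
  elements of the index type of vectors, and \<open>e\<close> is the sign \<open>\<epsilon>\<^sub>k\<^sub>l\<close>; so \<open>\<omega>'\<^sub>k = - e \<omega>\<^sub>l\<close>.\<close>

definition dual_index :: "nat \<Rightarrow> 2 \<Rightarrow> nat \<Rightarrow> 2 \<Rightarrow> real \<Rightarrow> bool" where
  "dual_index k n l m e \<longleftrightarrow>
     k = 1 \<and> n = 1 \<and> l = 2 \<and> m = 2 \<and> e = 1 \<or> k = 2 \<and> n = 2 \<and> l = 1 \<and> m = 1 \<and> e = -1"

lemma dual_index_exists: "k \<in> {1, 2} \<Longrightarrow> \<exists>n l m e. dual_index k n l m e"
  by (auto simp: dual_index_def)

text \<open>Adding the last two terms on the right leaves, besides the left side, only the second
  derivatives of \<open>f\<close> along \<open>i j\<close> and \<open>j j\<close>, and these form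
  \<open>Q 1 2\<close>.\<close>

lemma Q_temporal:
  assumes "dual_index i p j q s" and f: "smooth f"
  shows "Q 0 i (pd 0 f) g z
    = - s * Q 1 2 (pd j f) g z - Q0 (pd i f) g z + dAlembert f z * pd i g z"
  using assms(1) pd_commute[OF f, of 0 1 z] pd_commute[OF f, of 0 2 z] pd_commute[OF f, of 1 2 z]
  unfolding dual_index_def Q_def Q0_def dAlembert_def sum_1_2
  by (elim disjE conjE) (simp_all add: algebra_simps)

text \<open>Once \<open>Rot\<close> is expressed through \<open>omega\<close> and |x| cancels, this
  is a polynomial identity, checked in the four cases for \<open>i\<close> and
  \<open>k\<close>.\<close>

lemma Q_spatial:
  assumes ip: "dual_index i p j q s" and kl: "dual_index k n l m e"
    and f: "smooth f" and z: "snd z \<noteq> 0"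
  shows "Q 0 i (pd k f) g z = - (omega z $ p * omega z $ n) * Q0 (pd 0 f) g z
    + omega z $ p * omega z $ n * dAlembert f z * pd 0 g z
    - (s * omega z $ q * (Rot g z * pd 0 (pd k f) z - Rot (pd k f) z * pd 0 g z)
       + e * omega z $ p * (Rot (pd 0 f) z * pd l g z - Rot (pd l f) z * pd 0 g z)) / rad z"
proof -
  have "rad z \<noteq> 0" using z by (simp add: rad_def)
  then have r: "(a * (rad z * x * t - rad z * y * t') + b * (rad z * v * s - rad z * u * s')) / rad z
      = a * (x * t - y * t') + b * (v * s - u * s')" for a b x y u v t t' s s'
    by (simp add: field_simps)
  note commute = pd_commute[OF f, of 0 1 z] pd_commute[OF f, of 0 2 z] pd_commute[OF f, of 1 2 z]
  \<comment> \<open>The right-hand side is homogeneous of degree 2 in \<open>\<omega>\<close>; after this step both sides are.\<close>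
  have "Q 0 i (pd k f) g z = ((omega z $ 1)\<^sup>2 + (omega z $ 2)\<^sup>2) * Q 0 i (pd k f) g z"
    using omega_unit[OF z] by simp
  also have "\<dots> = - (omega z $ p * omega z $ n) * Q0 (pd 0 f) g z
    + omega z $ p * omega z $ n * dAlembert f z * pd 0 g z
    - (s * omega z $ q * (Rot g z * pd 0 (pd k f) z - Rot (pd k f) z * pd 0 g z)
       + e * omega z $ p * (Rot (pd 0 f) z * pd l g z - Rot (pd l f) z * pd 0 g z)) / rad z"
    using ip kl unfolding dual_index_def Rot_eq_omega[OF z] r
    by (elim disjE conjE) (simp_all add: Q_def Q0_def dAlembert_def sum_1_2[unfolded One_nat_def]
        commute[unfolded One_nat_def] algebra_simps power2_eq_square)
  finally show ?thesis .
qed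

text \<open>Leibniz rule read backwards: the terms with a derivative on \<open>g\<close> fix the
  three products to differentiate, and the last summand corrects for the derivative of their
  coefficients.\<close>

lemma Q_spatial_remainder:
  assumes ip: "dual_index i p j q s" and kl: "dual_index k n l m e"
    and f: "smooth f" and g: "smooth g" and z: "snd z \<noteq> 0"
  shows "- ((s * omega z $ q * (Rot g z * pd 0 (pd k f) z - Rot (pd k f) z * pd 0 g z)
       + e * omega z $ p * (Rot (pd 0 f) z * pd l g z - Rot (pd l f) z * pd 0 g z)) / rad z)
    = pd 0 (\<lambda>y. (s * omega y $ q * g y * Rot (pd k f) y + e * omega y $ p * g y * Rot (pd l f) y) / rad y) z
    + pd l (\<lambda>y. - (e * omega y $ p) * g y * Rot (pd 0 f) y / rad y) z
    + Rot (\<lambda>y. - (s * omega y $ q) * g y * pd 0 (pd k f) y / rad y) z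
    + e * ((if l = i then 1 else 0) - 2 * omega z $ p * omega z $ m) * g z * Rot (pd 0 f) z / (rad z)\<^sup>2"
proof -
  \<comment> \<open>Merging 1/|x| with \<open>omega\<close> leaves one kind of coefficient to
    differentiate.\<close>
  define w where "w n y = omega y $ n / rad y" for n and y :: spacetime
  define dw where "dw \<mu> n = (snd (coord_dir \<mu>) $ n - 2 * omega z $ n *
      (omega z $ 1 * snd (coord_dir \<mu>) $ 1 + omega z $ 2 * snd (coord_dir \<mu>) $ 2)) / (rad z)\<^sup>2"
    for \<mu> and n :: 2
  have has_dw: "has_pd \<mu> (w n) (dw \<mu> n) z" for \<mu> n
    using has_pd_omega_div_rad[OF z, of \<mu> n] by (simp add: w_def[abs_def] dw_def)
  have le: "k \<le> 2" "l \<le> 2" using kl by (auto simp: dual_index_def)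
  define comm where "comm = snd (coord_dir l) $ 1 * pd 2 (pd 0 f) z - snd (coord_dir l) $ 2 * pd 1 (pd 0 f) z"
  have dRot0: "has_pd 0 (Rot (pd \<nu> f)) (Rot (pd 0 (pd \<nu> f)) z) z" if "\<nu> \<le> 2" for \<nu>
    using has_pd_Rot[OF smooth_pd[OF f that], of 0 z] by (simp add: coord_dir_nth)
  have dRotl: "has_pd l (Rot (pd 0 f)) (Rot (pd l (pd 0 f)) z + comm) z"
    using has_pd_Rot[OF smooth_pd[OF f, of 0] le(2), of z] by (simp add: comm_def algebra_simps)
  note rules = has_pd_add has_pd_cmult has_pd_mult has_dw has_pd_smooth[OF g]
  have 1: "pd 0 (\<lambda>y. (s * omega y $ q * g y * Rot (pd k f) y + e * omega y $ p * g y * Rot (pd l f) y) / rad y) z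
    = s * w q z * (pd 0 g z * Rot (pd k f) z + g z * Rot (pd 0 (pd k f)) z)
      + e * w p z * (pd 0 g z * Rot (pd l f) z + g z * Rot (pd 0 (pd l f)) z)" (is "pd 0 ?F z = _")
  proof (rule pd_eqI)
    have eq: "?F = (\<lambda>y. s * (w q y * (g y * Rot (pd k f) y)) + e * (w p y * (g y * Rot (pd l f) y)))"
      by (simp add: w_def add_divide_distrib mult_ac)
    \<comment> \<open>The coefficients do not depend on time.\<close>
    have "dw 0 n = 0" for n by (simp add: dw_def coord_dir_nth)
    then show "has_pd 0 ?F (s * w q z * (pd 0 g z * Rot (pd k f) z + g z * Rot (pd 0 (pd k f)) z)
      + e * w p z * (pd 0 g z * Rot (pd l f) z + g z * Rot (pd 0 (pd l f)) z)) z"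
      unfolding eq
      by - (rule has_pd_eq_rhs, (rule rules dRot0 le)+, simp add: algebra_simps)
  qed
  have 2: "pd l (\<lambda>y. - (e * omega y $ p) * g y * Rot (pd 0 f) y / rad y) z
    = - e * (dw l p * (g z * Rot (pd 0 f) z) + w p z * (pd l g z * Rot (pd 0 f) z
       + g z * (Rot (pd l (pd 0 f)) z + comm)))" (is "pd l ?F z = ?D")
  proof (rule pd_eqI)
    have eq: "?F = (\<lambda>y. - e * (w p y * (g y * Rot (pd 0 f) y)))" by (auto simp: w_def)
    show "has_pd l ?F ?D z"
      unfolding eq by (rule has_pd_eq_rhs, (rule rules dRotl)+) (simp add: algebra_simps)
  qed
  \<comment> \<open>The angular derivative of \<open>w q\<close>; below, \<open>s * wr = w p\<close>
    because rotation fixes |x| and turns \<open>omega\<close>.\<close>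
  define wr where "wr = snd z $ 1 * dw 2 q - snd z $ 2 * dw 1 q"
  have 3: "Rot (\<lambda>y. - (s * omega y $ q) * g y * pd 0 (pd k f) y / rad y) z
    = - s * (wr * (g z * pd 0 (pd k f) z)
        + w q z * (Rot g z * pd 0 (pd k f) z + g z * Rot (pd 0 (pd k f)) z))" (is "Rot ?F z = ?D")
  proof -
    have eq: "?F = (\<lambda>y. - s * (w q y * (g y * pd 0 (pd k f) y)))" by (auto simp: w_def)
    have smooth': "smooth (pd 0 (pd k f))" by (intro smooth_pd f le zero_le)
    have "has_pd \<mu> ?F (- s * (dw \<mu> q * (g z * pd 0 (pd k f) z)
        + w q z * (pd \<mu> g z * pd 0 (pd k f) z + g z * pd \<mu> (pd 0 (pd k f)) z))) z" for \<mu>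
      unfolding eq by (rule rules has_pd_smooth[OF smooth'])+
    from Rot_eqI[OF this this] show ?thesis
      by (simp add: Rot_def wr_def algebra_simps)
  qed
  have "rad z \<noteq> 0" using z by (simp add: rad_def)
  then have wr_eq: "wr = (omega z $ 1 * (snd (coord_dir 2) $ q - 2 * omega z $ q * omega z $ 2)
      - omega z $ 2 * (snd (coord_dir 1) $ q - 2 * omega z $ q * omega z $ 1)) / rad z"
    by (simp add: wr_def dw_def rad_omega[OF z] coord_dir_nth del: One_nat_def)
      (simp add: power2_eq_square diff_divide_distrib)
  have wr: "s * wr = w p z"
    using ip unfolding dual_index_def wr_eq w_def by (auto simp: coord_dir_nth algebra_simps simp del: One_nat_def)
  \<comment> \<open>\<open>Rot\<close> differentiates its argument, so the partials must commute as
    functions; this cancels the third order terms.\<close>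
  have c: "Rot (pd l (pd 0 f)) z = Rot (pd 0 (pd l f)) z"
    using pd_commute[OF f le(2), of 0] by (metis ext zero_le)
  have comm: "e * comm = - pd 0 (pd k f) z"
    using kl[unfolded dual_index_def] pd_commute[OF f, of 0 1 z] pd_commute[OF f, of 0 2 z]
    by (auto simp: comm_def coord_dir_nth simp del: One_nat_def)
  have dl: "dw l p = ((if l = i then 1 else 0) - 2 * omega z $ p * omega z $ m) / (rad z)\<^sup>2"
    using ip kl unfolding dual_index_def dw_def
    by (elim disjE conjE) (simp_all add: coord_dir_nth del: One_nat_def)
  have L: "- ((a * omega z $ q * A + b * omega z $ p * B) / rad z) = - (a * w q z * A) - b * w p z * B" for a b A B
    by (simp add: w_def add_divide_distrib)
  have D: "e * ((if l = i then 1 else 0) - 2 * omega z $ p * omega z $ m) * g z * Rot (pd 0 f) z / (rad z)\<^sup>2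
    = e * dw l p * g z * Rot (pd 0 f) z" by (simp add: dl)
  \<comment> \<open>Here and in \<open>comm'\<close> the term
    \<open>w p z * g z * pd 0 (pd k f) z\<close> is split off, with opposite signs.\<close>
  have wr': "- s * (wr * X + Y) = - w p z * X - s * Y" for X Y
    by (simp add: wr[symmetric] algebra_simps)
  have comm': "- e * (U + w p z * (V + g z * (W + comm)))
      = - e * (U + w p z * (V + g z * W)) + w p z * g z * pd 0 (pd k f) z" for U V W
    using arg_cong[OF comm, of "\<lambda>x. w p z * g z * x"] by (simp add: algebra_simps)
  show ?thesis
    unfolding 1 2 3 L D c wr' comm' by (simp add: algebra_simps)
qed

section \<open>Polynomial coefficients and assembly of both formulas\<close>

lemma real_polynomial_function_vec_nth: "real_polynomial_function (\<lambda>w :: real^'n::finite. w $ n)"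
  by (rule real_polynomial_function.intros(1)) (rule bounded_linear_vec_nth)

text \<open>The condition \<open>b\<close> is independent of \<open>w\<close>: it selects
  coefficients by their indices.\<close>

lemma real_polynomial_function_if:
  "real_polynomial_function p \<Longrightarrow> real_polynomial_function q \<Longrightarrow>
    real_polynomial_function (\<lambda>w. if b then p w else q w)"
  by (cases b) simp_all

text \<open>Naming the summands by \<open>k\<close> and \<open>l\<close> lets coefficients defined
  by index tests simplify without a case split.\<close>

lemma sum_dual_index:
  fixes h :: "nat \<Rightarrow> real"
  assumes "dual_index k n l m e"
  shows "(\<Sum>\<mu>=0..2. h \<mu>) = h 0 + h k + h l"
  using assms by (auto simp: dual_index_def sum_0_2 simp del: One_nat_def)

lemma pd_zero: "pd \<mu> (\<lambda>y. 0) z = 0"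
  by (rule pd_eqI) (rule has_pd_const)

lemma Rot_zero: "Rot (\<lambda>y. 0) z = 0"
  by (simp add: Rot_def pd_zero)

theorem lemma2p3:
  fixes i \<alpha> :: nat
  assumes "i \<in> {1, 2}" and "\<alpha> \<in> {0, 1, 2}"
  shows
    "\<exists>(K :: nat \<Rightarrow> real)
       (P0 :: nat \<Rightarrow> real^2 \<Rightarrow> real) (P :: nat \<Rightarrow> real^2 \<Rightarrow> real)
       (P1 :: nat \<Rightarrow> nat \<Rightarrow> real^2 \<Rightarrow> real) (P2 :: nat \<Rightarrow> nat \<Rightarrow> real^2 \<Rightarrow> real)
       (A :: nat \<Rightarrow> nat \<Rightarrow> real^2 \<Rightarrow> real) (B :: nat \<Rightarrow> nat \<Rightarrow> real^2 \<Rightarrow> real)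
       (D :: nat \<Rightarrow> real^2 \<Rightarrow> real).
       (\<forall>\<mu>\<in>{0..2}. real_polynomial_function (P0 \<mu>) \<and> real_polynomial_function (P \<mu>)
          \<and> real_polynomial_function (D \<mu>)) \<and>
       (\<forall>\<mu>\<in>{0..2}. \<forall>\<nu>\<in>{0..2}. real_polynomial_function (P1 \<mu> \<nu>)
          \<and> real_polynomial_function (P2 \<mu> \<nu>)
          \<and> real_polynomial_function (A \<mu> \<nu>) \<and> real_polynomial_function (B \<mu> \<nu>)) \<and>
       (\<forall>f g. smooth f \<longrightarrow> smooth g \<longrightarrow>
         (\<forall>z. snd z \<noteq> 0 \<longrightarrow>
           Q 0 i (pd \<alpha> f) g z =
             (\<Sum>\<mu>=0..2. K \<mu> * Q 1 2 (pd \<mu> f) g z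
                + P0 \<mu> (omega z) * Q0 (pd \<mu> f) g z
                + P \<mu> (omega z) * dAlembert f z * pd \<mu> g z)
           + (\<Sum>\<mu>=0..2. \<Sum>\<nu>=0..2.
                (P1 \<mu> \<nu> (omega z) * Rot (pd \<mu> f) z * pd \<nu> g z
                 + P2 \<mu> \<nu> (omega z) * Rot g z * pd \<mu> (pd \<nu> f) z) / rad z)
         \<and>
           Q 0 i (pd \<alpha> f) g z =
             (\<Sum>\<mu>=0..2. K \<mu> * Q 1 2 (pd \<mu> f) g z
                + P0 \<mu> (omega z) * Q0 (pd \<mu> f) g z
                + P \<mu> (omega z) * dAlembert f z * pd \<mu> g z)
           + (\<Sum>\<mu>=0..2. pd \<mu> (\<lambda>y. (\<Sum>\<nu>=0..2. A \<mu> \<nu> (omega y) * g y * Rot (pd \<nu> f) y) / rad y) z)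
           + Rot (\<lambda>y. (\<Sum>\<nu>=0..2. \<Sum>\<kappa>=0..2.
                 B \<nu> \<kappa> (omega y) * g y * pd \<nu> (pd \<kappa> f) y) / rad y) z
           + (\<Sum>\<nu>=0..2. D \<nu> (omega z) * g z * Rot (pd \<nu> f) z) / (rad z)^2))"
proof -
  from assms(1) obtain p j q s where ip: "dual_index i p j q s"
    using dual_index_exists by blast
  note poly_intros = real_polynomial_function_if real_polynomial_function_minus
    real_polynomial_function_diff real_polynomial_function.intros(2-) real_polynomial_function_vec_nth
  consider (temporal) "\<alpha> = 0" | (spatial) "\<alpha> \<in> {1, 2}" using assms(2) by blast
  then show ?thesis
  proof cases
    case temporal
    define K where "K \<mu> = (if \<mu> = j then - s else 0)" for \<mu>
    define P where "P \<mu> w = (if \<mu> = i then 1 else 0 :: real)" for \<mu> and w :: "real^2"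
    note sums = sum_dual_index[OF ip]
    have ne: "i \<noteq> 0" "j \<noteq> 0" "i \<noteq> j" using ip by (auto simp: dual_index_def)
    have polys: "real_polynomial_function (P \<mu>)" "real_polynomial_function (\<lambda>w. - P \<mu> w)"
      "real_polynomial_function (\<lambda>w :: real^2. 0)" for \<mu>
      unfolding P_def[abs_def] by (rule poly_intros)+
    show ?thesis
    proof (rule exI[of _ K], rule exI[of _ "\<lambda>\<mu> w. - P \<mu> w"], rule exI[of _ P],
        rule exI[of _ "\<lambda>\<mu> \<nu> w. 0"], rule exI[of _ "\<lambda>\<mu> \<nu> w. 0"], rule exI[of _ "\<lambda>\<mu> \<nu> w. 0"],
        rule exI[of _ "\<lambda>\<mu> \<nu> w. 0"], rule exI[of _ "\<lambda>\<mu> w. 0"], intro conjI ballI allI impI polys)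
      fix f g :: "spacetime \<Rightarrow> real" and z :: spacetime
      assume f: "smooth f" and z: "snd z \<noteq> 0"
      have Q: "Q 0 i (pd \<alpha> f) g z = (\<Sum>\<mu>=0..2. K \<mu> * Q 1 2 (pd \<mu> f) g z
          + - P \<mu> (omega z) * Q0 (pd \<mu> f) g z + P \<mu> (omega z) * dAlembert f z * pd \<mu> g z)"
        unfolding sums temporal Q_temporal[OF ip f] using ne by (simp add: K_def P_def)
      note zero = mult_zero_left sum.neutral_const add_0_left add_0_right div_0 pd_zero Rot_zero
      show "Q 0 i (pd \<alpha> f) g z = (\<Sum>\<mu>=0..2. K \<mu> * Q 1 2 (pd \<mu> f) g z
          + - P \<mu> (omega z) * Q0 (pd \<mu> f) g z + P \<mu> (omega z) * dAlembert f z * pd \<mu> g z)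
          + (\<Sum>\<mu>=0..2. \<Sum>\<nu>=0..2.
              (0 * Rot (pd \<mu> f) z * pd \<nu> g z + 0 * Rot g z * pd \<mu> (pd \<nu> f) z) / rad z)"
        unfolding zero by (rule Q)
      show "Q 0 i (pd \<alpha> f) g z = (\<Sum>\<mu>=0..2. K \<mu> * Q 1 2 (pd \<mu> f) g z
          + - P \<mu> (omega z) * Q0 (pd \<mu> f) g z + P \<mu> (omega z) * dAlembert f z * pd \<mu> g z)
          + (\<Sum>\<mu>=0..2. pd \<mu> (\<lambda>y. (\<Sum>\<nu>=0..2. 0 * g y * Rot (pd \<nu> f) y) / rad y) z)
          + Rot (\<lambda>y. (\<Sum>\<nu>=0..2. \<Sum>\<kappa>=0..2. 0 * g y * pd \<nu> (pd \<kappa> f) y) / rad y) z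
          + (\<Sum>\<nu>=0..2. 0 * g z * Rot (pd \<nu> f) z) / (rad z)\<^sup>2"
        unfolding zero by (rule Q)
    qed
  next
    case spatial
    then obtain n l m e where kl: "dual_index \<alpha> n l m e"
      using dual_index_exists by blast
    then have ne: "\<alpha> \<noteq> 0" "l \<noteq> 0" "\<alpha> \<noteq> l" by (auto simp: dual_index_def)
    define P where "P \<mu> w = (if \<mu> = 0 then w $ p * w $ n else 0)" for \<mu> :: nat and w :: "real^2"
    \<comment> \<open>Read off from \<open>Q_spatial_remainder\<close>: \<open>\<mu>\<close> is the
      outer derivative, \<open>\<nu>\<close> the one under \<open>Rot\<close>.\<close>
    define A where "A \<mu> \<nu> w = (if \<mu> = 0 \<and> \<nu> = \<alpha> then s * w $ q else if \<mu> = 0 \<and> \<nu> = l then e * w $ p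
      else if \<mu> = l \<and> \<nu> = 0 then - (e * w $ p) else 0)" for \<mu> \<nu> and w :: "real^2"
    define B where "B \<mu> \<nu> w = (if \<mu> = 0 \<and> \<nu> = \<alpha> then - (s * w $ q) else 0)" for \<mu> \<nu> :: nat and w :: "real^2"
    define D where "D \<mu> w = (if \<mu> = 0 then e * ((if l = i then 1 else 0) - 2 * w $ p * w $ m) else 0)"
      for \<mu> :: nat and w :: "real^2"
    have polys: "real_polynomial_function (P \<mu>)" "real_polynomial_function (\<lambda>w. - P \<mu> w)"
      "real_polynomial_function (D \<mu>)" "real_polynomial_function (A \<mu> \<nu>)"
      "real_polynomial_function (B \<mu> \<nu>)" for \<mu> \<nu>
      unfolding P_def[abs_def] A_def[abs_def] B_def[abs_def] D_def[abs_def]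
      by (rule poly_intros)+
    note sums = sum_dual_index[OF kl]
    show ?thesis
    \<comment> \<open>Both formulas share \<open>A\<close> (transposed in the first) and
      \<open>B\<close>, since the derivatives falling on \<open>g\<close> in the second reproduce
      the error of the first.\<close>
    proof (rule exI[of _ "\<lambda>\<mu>. 0"], rule exI[of _ "\<lambda>\<mu> w. - P \<mu> w"], rule exI[of _ P],
        rule exI[of _ "\<lambda>\<mu> \<nu>. A \<nu> \<mu>"], rule exI[of _ B], rule exI[of _ A], rule exI[of _ B],
        rule exI[of _ D], intro conjI ballI allI impI polys)
      fix f g :: "spacetime \<Rightarrow> real" and z :: spacetime
      assume f: "smooth f" and g: "smooth g" and z: "snd z \<noteq> 0"
      let ?N = "\<Sum>\<mu>=0..2. 0 * Q 1 2 (pd \<mu> f) g z + - P \<mu> (omega z) * Q0 (pd \<mu> f) g z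
                + P \<mu> (omega z) * dAlembert f z * pd \<mu> g z"
      let ?R = "- ((s * omega z $ q * (Rot g z * pd 0 (pd \<alpha> f) z - Rot (pd \<alpha> f) z * pd 0 g z)
        + e * omega z $ p * (Rot (pd 0 f) z * pd l g z - Rot (pd l f) z * pd 0 g z)) / rad z)"
      have Q: "Q 0 i (pd \<alpha> f) g z = ?N + ?R"
        unfolding Q_spatial[OF ip kl f z] sums using ne by (simp add: P_def)
      have R: "?R = (\<Sum>\<mu>=0..2. \<Sum>\<nu>=0..2. (A \<nu> \<mu> (omega z) * Rot (pd \<mu> f) z * pd \<nu> g z
          + B \<mu> \<nu> (omega z) * Rot g z * pd \<mu> (pd \<nu> f) z) / rad z)"
        unfolding sums add_divide_distrib[symmetric] minus_divide_left
        using ne by (simp add: A_def B_def algebra_simps)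
      show "Q 0 i (pd \<alpha> f) g z = ?N
          + (\<Sum>\<mu>=0..2. \<Sum>\<nu>=0..2. (A \<nu> \<mu> (omega z) * Rot (pd \<mu> f) z * pd \<nu> g z
            + B \<mu> \<nu> (omega z) * Rot g z * pd \<mu> (pd \<nu> f) z) / rad z)"
        unfolding Q R ..
      show "Q 0 i (pd \<alpha> f) g z = ?N
          + (\<Sum>\<mu>=0..2. pd \<mu> (\<lambda>y. (\<Sum>\<nu>=0..2. A \<mu> \<nu> (omega y) * g y * Rot (pd \<nu> f) y) / rad y) z)
          + Rot (\<lambda>y. (\<Sum>\<nu>=0..2. \<Sum>\<kappa>=0..2. B \<nu> \<kappa> (omega y) * g y * pd \<nu> (pd \<kappa> f) y) / rad y) z
          + (\<Sum>\<nu>=0..2. D \<nu> (omega z) * g z * Rot (pd \<nu> f) z) / (rad z)\<^sup>2"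
        unfolding Q Q_spatial_remainder[OF ip kl f g z] sums
        using ne by (simp add: A_def B_def D_def pd_zero)
    qed
  qed
qed

end
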